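(* Let $(\mathcal{A},C_S)$ be a complete composed $S$-metric space with non-constant control function $\alpha:[0,\infty)\to[0,\infty)$. Let $F:\mathcal{A}\to\mathcal{A}$ be a mapping for which there is $r\in(0,1)$ such that $$C_S(Fq,Fh,Fw)\le r\,C_S(q,h,w)\qquad\text{for all } q,h,w\in\mathcal{A}.$$ Let $I_0\in\mathcal{A}$ and define the sequence $(I_n)$ by $I_n=F^nI_0$. Suppose that: 1. $\alpha(ks+t)\le k\,\alpha(s)+\alpha(t)$ for all positive numbers $s,t,k$; 2. $\alpha(0)=0$; 3. $$\lim_{\substack{n,m\to\infty\\ m>n}}\left[\sum_{k=n+3}^{m-2}2^{k-n-1}\alpha^{k-n+1}\big(r^kC_S(I_0,I_0,I_1)\big)+2^{m-n-2}\alpha^{m-n-1}\big(r^mC_S(I_0,I_0,I_1)\big)\right]=0.$$ Then $F$ has a unique fixed point.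
   Context: Composed $S$-metric space: let $\mathcal{A}$ be a nonempty set and $\alpha:[0,\infty)\to[0,\infty)$ a non-constant function (the control, or composed, function). A function $C_S:\mathcal{A}^3\to[0,\infty)$ is a composed $S$-metric if for all $q,h,w,u\in\mathcal{A}$: (1) $C_S(q,h,w)=0$ if and only if $q=h=w$; (2) $C_S(q,h,w)\le\alpha(C_S(q,q,u))+\alpha(C_S(h,h,u))+\alpha(C_S(w,w,u))$. The pair $(\mathcal{A},C_S)$ is then called a composed $S$-metric space. A sequence $(q_n)$ in $\mathcal{A}$ converges to $q\in\mathcal{A}$ if $C_S(q_n,q_n,q)\to0$ as $n\to\infty$. It is Cauchy if $C_S(q_n,q_n,q_m)\to0$ as $n,m\to\infty$. The space is complete if every Cauchy sequence in it converges to a point of $\mathcal{A}$. $F^n$ denotes the $n$-fold composition of $F$, and $\alpha^j$ denotes the $j$-fold composition of $\alpha$ with itself ($\alpha^0$ is the identity). Empty sums are $0$. *)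

theory Defs
  imports Complex_Main "HOL-Library.FuncSet"
begin

text \<open>The half-line \<open>[0,\<infinity>)\<close> is rendered as \<open>{0..}\<close> inside \<^typ>\<open>real\<close>; values of \<open>\<alpha>\<close> at
  negative arguments and of \<open>C\<close> outside \<open>A\<close> are irrelevant.\<close>

locale composed_S_metric_space =
  fixes A :: "'a set"
    and C :: "'a \<Rightarrow> 'a \<Rightarrow> 'a \<Rightarrow> real"
    and \<alpha> :: "real \<Rightarrow> real"
  assumes nonempty: "A \<noteq> {}"
    and control_maps: "\<alpha> \<in> {0..} \<rightarrow> {0..}"
    and control_nonconst: "\<exists>s\<in>{0..}. \<exists>t\<in>{0..}. \<alpha> s \<noteq> \<alpha> t"
    and nonneg: "\<lbrakk>q \<in> A; h \<in> A; w \<in> A\<rbrakk> \<Longrightarrow> 0 \<le> C q h w"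
    and eq_zero_iff: "\<lbrakk>q \<in> A; h \<in> A; w \<in> A\<rbrakk> \<Longrightarrow> C q h w = 0 \<longleftrightarrow> q = h \<and> h = w"
    and composed_ineq: "\<lbrakk>q \<in> A; h \<in> A; w \<in> A; u \<in> A\<rbrakk> \<Longrightarrow>
      C q h w \<le> \<alpha> (C q q u) + \<alpha> (C h h u) + \<alpha> (C w w u)"

definition S_converges_to :: "('a \<Rightarrow> 'a \<Rightarrow> 'a \<Rightarrow> real) \<Rightarrow> (nat \<Rightarrow> 'a) \<Rightarrow> 'a \<Rightarrow> bool" where
  "S_converges_to C X q \<longleftrightarrow> (\<lambda>n. C (X n) (X n) q) \<longlonglongrightarrow> 0"

definition S_Cauchy :: "('a \<Rightarrow> 'a \<Rightarrow> 'a \<Rightarrow> real) \<Rightarrow> (nat \<Rightarrow> 'a) \<Rightarrow> bool" where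
  "S_Cauchy C X \<longleftrightarrow>
     ((\<lambda>(n, m). C (X n) (X n) (X m)) \<longlongrightarrow> 0) (sequentially \<times>\<^sub>F sequentially)"

definition S_complete :: "'a set \<Rightarrow> ('a \<Rightarrow> 'a \<Rightarrow> 'a \<Rightarrow> real) \<Rightarrow> bool" where
  "S_complete A C \<longleftrightarrow>
     (\<forall>X. range X \<subseteq> A \<and> S_Cauchy C X \<longrightarrow> (\<exists>q\<in>A. S_converges_to C X q))"

text \<open>The double limit \<open>n, m \<rightarrow> \<infinity>\<close> subject to \<open>m > n\<close>, as a filter on pairs \<open>(n, m)\<close>.\<close>

definition pairs_above :: "(nat \<times> nat) filter" where
  "pairs_above = inf (sequentially \<times>\<^sub>F sequentially) (principal {(n, m). n < m})"

text \<open>For \<open>m = n + 1\<close> the exponent \<open>m - n - 2\<close> equals \<open>-1\<close>, so the power of 2 in the last term takes an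
  integer exponent. All natural-number subtractions below are exact when \<open>m > n\<close>, except that
  \<open>m - 2\<close> truncates for \<open>m = 1\<close>; the sum is empty there in any case.\<close>

definition control_expr :: "(real \<Rightarrow> real) \<Rightarrow> real \<Rightarrow> real \<Rightarrow> nat \<Rightarrow> nat \<Rightarrow> real" where
  "control_expr \<alpha> r c n m =
     (\<Sum>k = n + 3..m - 2. 2 ^ (k - n - 1) * (\<alpha> ^^ (k - n + 1)) (r ^ k * c))
     + 2 powi (int m - int n - 2) * (\<alpha> ^^ (m - n - 1)) (r ^ m * c)"

end

theory Submission
  imports Defs
begin

text \<open>Let \<open>c = C (I 0) (I 0) (I 1)\<close>. If \<open>c = 0\<close>, then \<open>I 0\<close> is itself a fixed point. If \<open>c > 0\<close>, the
  hypotheses on \<open>\<alpha>\<close> are rigid: on the diagonal \<open>m = n + 2\<close> the limit condition says that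
  \<open>\<alpha> (r ^ n * c) \<longrightarrow> 0\<close>, so \<open>\<alpha>\<close> tends to \<open>0\<close> along a sequence of positive numbers tending to \<open>0\<close>.
  Writing \<open>x = (x - t) * 1 + t\<close> and letting \<open>t\<close> run through that sequence, the inequality
  \<open>\<alpha> (k * s + t) \<le> k * \<alpha> s + \<alpha> t\<close> yields \<open>\<alpha> x \<le> \<alpha> 1 * x\<close> for all \<open>x \<ge> 0\<close>
  (lemma \<open>linear_bound_of_vanishing_sequence\<close>).

  Hence \<open>C\<close> satisfies the rectangle inequality with a linear control, and the contraction principle
  holds with any ratio \<open>r < 1\<close> (lemma \<open>contraction_has_fixed_point\<close>), although the constant in
  the inequality exceeds \<open>1\<close> in general. Summing the inequality along consecutive iterates would
  produce powers of that constant. Instead, the distances from the start of the orbit are shown to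
  be bounded: comparing them across a block of \<open>p\<close> iterates, with \<open>p\<close> so large that \<open>r ^ p\<close>
  outweighs the constant, gives a recursive bound with factor \<open>1 / 2\<close>. Boundedness together with
  the contraction makes the orbit a Cauchy sequence, and its limit is fixed.\<close>

text \<open>The inequality for \<open>\<alpha>\<close> with \<open>s = 1\<close> and \<open>k = x - t\<close> is an affine bound up to the error \<open>\<alpha> t\<close>,
  which has to be made small; without smallness near \<open>0\<close> the function equal to \<open>1\<close> on the
  positive reals also satisfies the inequality, with no bound of the form \<open>L * x\<close>.\<close>

lemma linear_bound_of_vanishing_sequence:
  fixes \<alpha> :: "real \<Rightarrow> real"
  assumes control: "\<And>s t k. \<lbrakk>0 < s; 0 < t; 0 < k\<rbrakk> \<Longrightarrow> \<alpha> (k * s + t) \<le> k * \<alpha> s + \<alpha> t"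
    and zero: "\<alpha> 0 = 0"
    and pos: "\<And>n. 0 < t n"
    and t_lim: "t \<longlonglongrightarrow> 0"
    and \<alpha>t_lim: "(\<lambda>n. \<alpha> (t n)) \<longlonglongrightarrow> 0"
    and "0 \<le> x"
  shows "\<alpha> x \<le> \<alpha> 1 * x"
proof (cases "x = 0")
  case True
  then show ?thesis using zero by simp
next
  case False
  with \<open>0 \<le> x\<close> have "0 < x" by simp
  have lim: "(\<lambda>n. (x - t n) * \<alpha> 1 + \<alpha> (t n)) \<longlonglongrightarrow> (x - 0) * \<alpha> 1 + 0"
    by (intro tendsto_intros t_lim \<alpha>t_lim)
  have "\<forall>\<^sub>F n in sequentially. t n < x"
    using t_lim \<open>0 < x\<close> by (rule order_tendstoD)
  then have "\<forall>\<^sub>F n in sequentially. \<alpha> x \<le> (x - t n) * \<alpha> 1 + \<alpha> (t n)"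
  proof eventually_elim
    case (elim n)
    show ?case
      using control[of 1 "t n" "x - t n"] pos[of n] elim by simp
  qed
  with lim have "\<alpha> x \<le> (x - 0) * \<alpha> 1 + 0"
    by (intro tendsto_lowerbound) auto
  then show ?thesis by (simp add: mult.commute)
qed

text \<open>On this diagonal the sum is empty, the power of \<open>2\<close> is \<open>2 powi 0\<close>, and \<open>\<alpha>\<close> is iterated exactly
  once.\<close>

lemma control_expr_diagonal:
  "control_expr \<alpha> r c n (n + 2) = \<alpha> (r ^ (n + 2) * c)"
  by (simp add: control_expr_def)

lemma control_vanishes_along_powers:
  assumes "((\<lambda>(n, m). control_expr \<alpha> r c n m) \<longlongrightarrow> 0) pairs_above"
  shows "(\<lambda>n. \<alpha> (r ^ (n + 2) * c)) \<longlonglongrightarrow> 0"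
proof -
  have "filterlim (\<lambda>n. (n, n + 2)) pairs_above sequentially"
    unfolding pairs_above_def filterlim_inf filterlim_principal
    by (intro conjI filterlim_Pair filterlim_ident filterlim_add_const_nat_at_top) auto
  from filterlim_compose[OF assms this] show ?thesis
    by (simp only: prod.case control_expr_diagonal)
qed

context composed_S_metric_space
begin

text \<open>Choosing \<open>u = q\<close> in the rectangle inequality makes two of its terms vanish.\<close>

lemma linear_control_almost_symmetric:
  assumes "\<And>x. 0 \<le> x \<Longrightarrow> \<alpha> x \<le> L * x" and "q \<in> A" and "w \<in> A"
  shows "C q q w \<le> L * C w w q"
proof -
  have "C q q q = 0" using eq_zero_iff assms(2) by blast
  moreover have "\<alpha> 0 \<le> 0" using assms(1)[of 0] by simp
  moreover have "\<alpha> (C w w q) \<le> L * C w w q" using assms nonneg by blast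
  ultimately show ?thesis using composed_ineq[of q q w q] assms(2,3) by simp
qed

lemma linear_control_triangle:
  assumes "\<And>x. 0 \<le> x \<Longrightarrow> \<alpha> x \<le> L * x" and "q \<in> A" and "w \<in> A" and "u \<in> A"
  shows "C q q w \<le> 2 * L * C q q u + L * C w w u"
proof -
  have "\<alpha> (C q q u) \<le> L * C q q u" "\<alpha> (C w w u) \<le> L * C w w u"
    using assms nonneg by blast+
  then show ?thesis using composed_ineq[of q q w u] assms(2-4) by simp
qed

lemma contraction_iterates:
  assumes "F \<in> A \<rightarrow> A" and "0 \<le> r"
    and contr: "\<And>q h w. \<lbrakk>q \<in> A; h \<in> A; w \<in> A\<rbrakk> \<Longrightarrow> C (F q) (F h) (F w) \<le> r * C q h w"
    and "q \<in> A" and "h \<in> A" and "w \<in> A"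
  shows "C ((F ^^ n) q) ((F ^^ n) h) ((F ^^ n) w) \<le> r ^ n * C q h w"
proof (induction n)
  case 0
  then show ?case by simp
next
  case (Suc n)
  have "(F ^^ n) z \<in> A" if "z \<in> A" for z
    using that assms(1) by (induction n) auto
  then have "C ((F ^^ Suc n) q) ((F ^^ Suc n) h) ((F ^^ Suc n) w)
      \<le> r * C ((F ^^ n) q) ((F ^^ n) h) ((F ^^ n) w)"
    using contr assms(4-6) by simp
  also have "\<dots> \<le> r * (r ^ n * C q h w)"
    using Suc \<open>0 \<le> r\<close> by (rule mult_left_mono)
  finally show ?case by (simp add: mult.assoc)
qed

text \<open>The intermediate point \<open>(F ^^ p) x\<close> splits the distance from \<open>x\<close> to a later iterate into a
  fixed part and a part that the contraction shrinks by \<open>r ^ p\<close>. The near-symmetry of \<open>C\<close> brings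
  the latter back to the form of the distance being bounded, with factor \<open>L\<^sup>2 * r ^ p\<close>; for large
  \<open>p\<close> this is at most \<open>1 / 2\<close>.\<close>

lemma contraction_orbit_bounded:
  assumes linear: "\<And>x. 0 \<le> x \<Longrightarrow> \<alpha> x \<le> L * x" and "0 \<le> L"
    and F: "F \<in> A \<rightarrow> A" and r: "0 \<le> r" "r < 1"
    and contr: "\<And>q h w. \<lbrakk>q \<in> A; h \<in> A; w \<in> A\<rbrakk> \<Longrightarrow> C (F q) (F h) (F w) \<le> r * C q h w"
    and x: "x \<in> A"
  obtains M where "0 \<le> M" and "\<And>k. C x x ((F ^^ k) x) \<le> M"
proof -
  have orbit: "(F ^^ n) x \<in> A" for n
    using F x by (induction n) auto
  have "(\<lambda>p. L\<^sup>2 * r ^ p) \<longlonglongrightarrow> L\<^sup>2 * 0"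
    using r by (intro tendsto_intros) auto
  then have "\<forall>\<^sub>F p in sequentially. L\<^sup>2 * r ^ p < 1 / 2"
    by (rule order_tendstoD) simp
  then obtain p0 where p0: "\<And>p. p \<ge> p0 \<Longrightarrow> L\<^sup>2 * r ^ p < 1 / 2"
    unfolding eventually_sequentially by blast
  define p where "p = Suc p0"
  have p: "L\<^sup>2 * r ^ p < 1 / 2" "0 < p"
    using p0[of p] by (simp_all add: p_def)
  define d where "d k = C x x ((F ^^ k) x)" for k
  have d_nonneg: "0 \<le> d k" for k
    unfolding d_def using nonneg x orbit by blast
  have step: "d (p + j) \<le> 2 * L * d p + (1 / 2) * d j" for j
  proof -
    have "C ((F ^^ (p + j)) x) ((F ^^ (p + j)) x) ((F ^^ p) x)
        \<le> r ^ p * C ((F ^^ j) x) ((F ^^ j) x) x"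
      using contraction_iterates[OF F r(1) contr orbit[of j] orbit[of j] x, of p]
      by (simp add: funpow_add)
    also have "\<dots> \<le> r ^ p * (L * d j)"
      unfolding d_def using r
      by (intro mult_left_mono linear_control_almost_symmetric linear orbit x) auto
    finally have "L * C ((F ^^ (p + j)) x) ((F ^^ (p + j)) x) ((F ^^ p) x)
        \<le> L * (r ^ p * (L * d j))"
      using \<open>0 \<le> L\<close> by (rule mult_left_mono)
    also have "\<dots> = L\<^sup>2 * r ^ p * d j"
      by (simp add: power2_eq_square)
    also have "\<dots> \<le> (1 / 2) * d j"
      using p d_nonneg by (intro mult_right_mono) auto
    finally show ?thesis
      using linear_control_triangle[OF linear x orbit[of "p + j"] orbit[of p]]
      unfolding d_def by simp
  qed
  \<comment> \<open>The summand \<open>4 * L * d p\<close> is the fixed point of \<open>M \<mapsto> 2 * L * d p + M / 2\<close>; the sum takes care of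
    the first block.\<close>
  define M where "M = 4 * L * d p + (\<Sum>k<p. d k)"
  have sum_nonneg: "0 \<le> (\<Sum>k<p. d k)"
    using d_nonneg by (simp add: sum_nonneg)
  have head_nonneg: "0 \<le> L * d p" using \<open>0 \<le> L\<close> d_nonneg by simp
  have "d k \<le> M" for k
  proof (induction k rule: less_induct)
    case (less k)
    show ?case
    proof (cases "k < p")
      case True
      then have "d k \<le> (\<Sum>k<p. d k)"
        using d_nonneg by (intro member_le_sum) auto
      then show ?thesis unfolding M_def using head_nonneg by simp
    next
      case False
      then have "d k \<le> 2 * L * d p + (1 / 2) * d (k - p)"
        using step[of "k - p"] by simp
      moreover have "d (k - p) \<le> M"
        using less False p by simp
      ultimately show ?thesis
        unfolding M_def using sum_nonneg by simp
    qed
  qed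
  moreover have "0 \<le> M" unfolding M_def using sum_nonneg head_nonneg by simp
  ultimately show ?thesis using that unfolding d_def by blast
qed

lemma contraction_orbit_Cauchy:
  assumes linear: "\<And>x. 0 \<le> x \<Longrightarrow> \<alpha> x \<le> L * x" and "0 \<le> L"
    and F: "F \<in> A \<rightarrow> A" and r: "0 \<le> r" "r < 1"
    and contr: "\<And>q h w. \<lbrakk>q \<in> A; h \<in> A; w \<in> A\<rbrakk> \<Longrightarrow> C (F q) (F h) (F w) \<le> r * C q h w"
    and x: "x \<in> A"
  shows "S_Cauchy C (\<lambda>n. (F ^^ n) x)"
proof -
  obtain M where M: "0 \<le> M" "\<And>k. C x x ((F ^^ k) x) \<le> M"
    using contraction_orbit_bounded[OF linear \<open>0 \<le> L\<close> F r contr x] by blast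
  have orbit: "(F ^^ n) x \<in> A" for n
    using F x by (induction n) auto
  have ordered: "C ((F ^^ n) x) ((F ^^ n) x) ((F ^^ m) x) \<le> r ^ n * M" if "n \<le> m" for n m
  proof -
    have "(F ^^ n) ((F ^^ (m - n)) x) = (F ^^ m) x"
      using that funpow_add[of n "m - n" F] by simp
    then have "C ((F ^^ n) x) ((F ^^ n) x) ((F ^^ m) x) \<le> r ^ n * C x x ((F ^^ (m - n)) x)"
      using contraction_iterates[OF F r(1) contr x x orbit[of "m - n"], of n] by simp
    also have "\<dots> \<le> r ^ n * M"
      using M r by (intro mult_left_mono) auto
    finally show ?thesis .
  qed
  have bound: "C ((F ^^ n) x) ((F ^^ n) x) ((F ^^ m) x) \<le> r ^ n * M + L * (r ^ m * M)" for n m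
  proof (cases "n \<le> m")
    case True
    have "0 \<le> L * (r ^ m * M)" using \<open>0 \<le> L\<close> r M by simp
    with ordered[OF True] show ?thesis by simp
  next
    case False
    have "C ((F ^^ n) x) ((F ^^ n) x) ((F ^^ m) x) \<le> L * C ((F ^^ m) x) ((F ^^ m) x) ((F ^^ n) x)"
      by (rule linear_control_almost_symmetric[OF linear orbit orbit])
    also have "\<dots> \<le> L * (r ^ m * M)"
      using ordered[of m n] False \<open>0 \<le> L\<close> by (intro mult_left_mono) auto
    moreover have "0 \<le> r ^ n * M" using r M by simp
    ultimately show ?thesis by simp
  qed
  have powers: "(\<lambda>n. r ^ n) \<longlonglongrightarrow> 0" using r by (rule LIMSEQ_realpow_zero)
  have fst_lim: "filterlim fst sequentially (sequentially \<times>\<^sub>F sequentially)"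
    and snd_lim: "filterlim snd sequentially (sequentially \<times>\<^sub>F sequentially)"
    unfolding filterlim_def by (rule filtermap_fst_prod_filter filtermap_snd_prod_filter)+
  have "((\<lambda>z. r ^ fst z * M + L * (r ^ snd z * M)) \<longlongrightarrow> 0 * M + L * (0 * M))
      (sequentially \<times>\<^sub>F sequentially)"
    by (intro tendsto_intros filterlim_compose[OF powers fst_lim] filterlim_compose[OF powers snd_lim])
  then have lim: "((\<lambda>z. r ^ fst z * M + L * (r ^ snd z * M)) \<longlongrightarrow> 0) (sequentially \<times>\<^sub>F sequentially)"
    by simp
  show ?thesis
    unfolding S_Cauchy_def
  proof (rule tendsto_sandwich[OF _ _ tendsto_const lim])
    show "\<forall>\<^sub>F z in sequentially \<times>\<^sub>F sequentially.
        0 \<le> (case z of (n, m) \<Rightarrow> C ((F ^^ n) x) ((F ^^ n) x) ((F ^^ m) x))"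
      using nonneg orbit by (auto intro!: always_eventually)
    show "\<forall>\<^sub>F z in sequentially \<times>\<^sub>F sequentially.
        (case z of (n, m) \<Rightarrow> C ((F ^^ n) x) ((F ^^ n) x) ((F ^^ m) x))
          \<le> r ^ fst z * M + L * (r ^ snd z * M)"
      using bound by (auto intro!: always_eventually)
  qed
qed

text \<open>The limit \<open>y\<close> of the orbit is compared with \<open>F y\<close> through the iterates: \<open>(F ^^ Suc n) x\<close> is close
  to \<open>y\<close> by convergence, and close to \<open>F y\<close> by the contraction.\<close>

lemma contraction_has_fixed_point:
  assumes linear: "\<And>x. 0 \<le> x \<Longrightarrow> \<alpha> x \<le> L * x" and "0 \<le> L"
    and complete: "S_complete A C"
    and F: "F \<in> A \<rightarrow> A" and r: "0 \<le> r" "r < 1"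
    and contr: "\<And>q h w. \<lbrakk>q \<in> A; h \<in> A; w \<in> A\<rbrakk> \<Longrightarrow> C (F q) (F h) (F w) \<le> r * C q h w"
  shows "\<exists>y\<in>A. F y = y"
proof -
  obtain x where x: "x \<in> A" using nonempty by blast
  have orbit: "(F ^^ n) x \<in> A" for n
    using F x by (induction n) auto
  have "S_Cauchy C (\<lambda>n. (F ^^ n) x)"
    by (rule contraction_orbit_Cauchy[OF linear \<open>0 \<le> L\<close> F r contr x])
  moreover have "range (\<lambda>n. (F ^^ n) x) \<subseteq> A" using orbit by auto
  ultimately have "\<exists>y\<in>A. S_converges_to C (\<lambda>n. (F ^^ n) x) y"
    using complete[unfolded S_complete_def, rule_format] by simp
  then obtain y where y: "y \<in> A" and "S_converges_to C (\<lambda>n. (F ^^ n) x) y" ..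
  then have conv: "(\<lambda>n. C ((F ^^ n) x) ((F ^^ n) x) y) \<longlonglongrightarrow> 0"
    unfolding S_converges_to_def by simp
  have Fy: "F y \<in> A" using F y by blast
  define e where "e n = C ((F ^^ n) x) ((F ^^ n) x) y" for n
  have e_lim: "e \<longlonglongrightarrow> 0" unfolding e_def by (rule conv)
  have bound: "C (F y) (F y) y \<le> 2 * L * (r * (L * e n)) + L * (L * e (Suc n))" for n
  proof -
    have "C (F y) (F y) ((F ^^ Suc n) x) \<le> r * C y y ((F ^^ n) x)"
      using contr[OF y y orbit[of n]] by simp
    also have "\<dots> \<le> r * (L * e n)"
      unfolding e_def using r
      by (intro mult_left_mono linear_control_almost_symmetric linear orbit y) auto
    finally have "2 * L * C (F y) (F y) ((F ^^ Suc n) x) \<le> 2 * L * (r * (L * e n))"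
      using \<open>0 \<le> L\<close> by (intro mult_left_mono) auto
    moreover have "L * C y y ((F ^^ Suc n) x) \<le> L * (L * e (Suc n))"
      unfolding e_def using \<open>0 \<le> L\<close>
      by (intro mult_left_mono linear_control_almost_symmetric linear orbit y) auto
    ultimately show ?thesis
      using linear_control_triangle[OF linear Fy y orbit[of "Suc n"]] by simp
  qed
  have "(\<lambda>n. 2 * L * (r * (L * e n)) + L * (L * e (Suc n)))
      \<longlonglongrightarrow> 2 * L * (r * (L * 0)) + L * (L * 0)"
    by (intro tendsto_intros e_lim LIMSEQ_Suc[OF e_lim])
  then have "C (F y) (F y) y \<le> 2 * L * (r * (L * 0)) + L * (L * 0)"
    using bound by (intro LIMSEQ_le_const) auto
  then have "C (F y) (F y) y = 0"
    using nonneg[OF Fy Fy y] by simp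
  then have "F y = y" using eq_zero_iff[OF Fy Fy y] by simp
  then show ?thesis using y by blast
qed

lemma contraction_fixed_point_unique:
  assumes "r < 1"
    and contr: "\<And>q h w. \<lbrakk>q \<in> A; h \<in> A; w \<in> A\<rbrakk> \<Longrightarrow> C (F q) (F h) (F w) \<le> r * C q h w"
    and y: "y \<in> A" "F y = y" and z: "z \<in> A" "F z = z"
  shows "y = z"
proof -
  have "C y y z \<le> r * C y y z" using contr[of y y z] y z by simp
  then have "(1 - r) * C y y z \<le> 0" by (simp add: algebra_simps)
  then have "C y y z \<le> 0" using \<open>r < 1\<close> by (simp add: mult_le_0_iff)
  then have "C y y z = 0" using nonneg[of y y z] y z by simp
  then show ?thesis using eq_zero_iff[of y y z] y z by simp
qed

end

theorem theorem3p1: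
  fixes A :: "'a set"
    and C :: "'a \<Rightarrow> 'a \<Rightarrow> 'a \<Rightarrow> real"
    and \<alpha> :: "real \<Rightarrow> real"
    and F :: "'a \<Rightarrow> 'a"
    and r :: real
    and I :: "nat \<Rightarrow> 'a"
  assumes "composed_S_metric_space A C \<alpha>"
    and "S_complete A C"
    and "F \<in> A \<rightarrow> A"
    and "0 < r" and "r < 1"
    and "\<And>q h w. \<lbrakk>q \<in> A; h \<in> A; w \<in> A\<rbrakk> \<Longrightarrow> C (F q) (F h) (F w) \<le> r * C q h w"
    and "I 0 \<in> A"
    and "\<And>n. I n = (F ^^ n) (I 0)"
    and "\<And>s t k. \<lbrakk>0 < s; 0 < t; 0 < k\<rbrakk> \<Longrightarrow> \<alpha> (k * s + t) \<le> k * \<alpha> s + \<alpha> t"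
    and "\<alpha> 0 = 0"
    and "((\<lambda>(n, m). control_expr \<alpha> r (C (I 0) (I 0) (I 1)) n m) \<longlongrightarrow> 0) pairs_above"
  shows "\<exists>!x. x \<in> A \<and> F x = x"
proof -
  interpret composed_S_metric_space A C \<alpha> by fact
  define c where "c = C (I 0) (I 0) (I 1)"
  have I1: "I 1 = F (I 0)" using assms(8)[of 1] by simp
  then have I1_mem: "I 1 \<in> A" using assms(3,7) by auto
  have "\<exists>y\<in>A. F y = y"
  proof (cases "c = 0")
    case True
    then have "I 0 = I 1"
      using eq_zero_iff[OF assms(7,7) I1_mem] by (simp add: c_def)
    then show ?thesis using I1 assms(7) by metis
  next
    case False
    then have "0 < c"
      using nonneg[OF assms(7,7) I1_mem] by (simp add: c_def)
    have pos: "0 < r ^ (n + 2) * c" for n using \<open>0 < c\<close> \<open>0 < r\<close> by simp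
    have "(\<lambda>n. r ^ n) \<longlonglongrightarrow> 0"
      using \<open>0 < r\<close> \<open>r < 1\<close> by (intro LIMSEQ_realpow_zero) auto
    then have "(\<lambda>n. r ^ (n + 2)) \<longlonglongrightarrow> 0"
      by (rule LIMSEQ_ignore_initial_segment)
    then have arg_lim: "(\<lambda>n. r ^ (n + 2) * c) \<longlonglongrightarrow> 0"
      by (rule tendsto_mult_left_zero)
    have val_lim: "(\<lambda>n. \<alpha> (r ^ (n + 2) * c)) \<longlonglongrightarrow> 0"
      using control_vanishes_along_powers[OF assms(11)] by (simp add: c_def)
    have linear: "\<alpha> x \<le> \<alpha> 1 * x" if "0 \<le> x" for x
      using linear_bound_of_vanishing_sequence[OF assms(9,10) pos arg_lim val_lim that] .
    have "0 \<le> \<alpha> 1" using control_maps by auto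
    show ?thesis
      using contraction_has_fixed_point[OF linear \<open>0 \<le> \<alpha> 1\<close> assms(2,3) _ \<open>r < 1\<close> assms(6)]
        \<open>0 < r\<close> by simp
  qed
  then show ?thesis
    using contraction_fixed_point_unique[OF \<open>r < 1\<close> assms(6)] by blast
qed

end
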